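(* If $\|\cdot\|$ is a Q-norm on $\mathcal M$, then for every $\Delta\in\mathcal M^{\geq}$ $$m(\Delta;\mathcal S_{\|\cdot\|})=\|E\|^{-2}\,\lambda_n(\Delta),$$ where $E=\mathrm{diag}(1,0,\ldots,0)\in\mathcal M$.
   Context: $n$ is a positive integer, $\mathcal M$ is the algebra of complex $n\times n$ matrices, $\mathcal M^{\geq}$ the cone of non-negative Hermitian matrices in $\mathcal M$; $\lambda_n(\Delta)$ is the smallest eigenvalue of $\Delta\in\mathcal M^{\geq}$. A norm $\|\cdot\|$ on $\mathcal M$ is unitarily invariant if $\|VAU\|=\|A\|$ for all $A\in\mathcal M$ and all unitary $U,V\in\mathcal M$. A unitarily invariant norm $\|\cdot\|$ on $\mathcal M$ is called a Q-norm if there exists a unitarily invariant norm $\|\cdot\|^{\wedge}$ on $\mathcal M$ such that $\|A\|^2=\|A^*A\|^{\wedge}$ for all $A\in\mathcal M$. $\mathcal S_{\|\cdot\|}=\{A\in\mathcal M:\|A\|=1\}$. For a non-empty $\mathcal A\subseteq\mathcal M$, $m(\Delta;\mathcal A)$ denotes $\inf\{\mathrm{tr}(A\Delta A^* ):A\in\mathcal A\}$ when this infimum is attained; an assertion $m(\Delta;\mathcal A)=c$ means that the infimum is attained and equals $c$. *)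

theory Defs
  imports
    "Jordan_Normal_Form.Matrix"
    "Jordan_Normal_Form.Char_Poly"
    "Jordan_Normal_Form.Schur_Decomposition"
    "Jordan_Normal_Form.Spectral_Radius"
begin

definition trace :: "complex mat \<Rightarrow> complex" where
  "trace A = (\<Sum>i<dim_row A. A $$ (i, i))"

definition unitary :: "nat \<Rightarrow> complex mat \<Rightarrow> bool" where
  "unitary n U \<longleftrightarrow> U \<in> carrier_mat n n
     \<and> mat_adjoint U * U = 1\<^sub>m n \<and> U * mat_adjoint U = 1\<^sub>m n"

text \<open>The last conjunct is an inequality in the order on the complex numbers, so it says that
  the quadratic form is real and non-negative.\<close>

definition nonneg_hermitian :: "nat \<Rightarrow> complex mat set" where
  "nonneg_hermitian n = {D \<in> carrier_mat n n. mat_adjoint D = D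
     \<and> (\<forall>v \<in> carrier_vec n. 0 \<le> (D *\<^sub>v v) \<bullet>c v)}"

text \<open>For a Hermitian matrix this is its smallest eigenvalue, as all eigenvalues are real.\<close>

definition min_eigenvalue :: "complex mat \<Rightarrow> real" where
  "min_eigenvalue D = Min {x :: real. complex_of_real x \<in> spectrum D}"

text \<open>Norms on the complex vector space of \<open>n \<times> n\<close> matrices. Nothing is required of \<open>N\<close>
  outside \<open>carrier_mat n n\<close>.\<close>

definition matrix_norm :: "nat \<Rightarrow> (complex mat \<Rightarrow> real) \<Rightarrow> bool" where
  "matrix_norm n N \<longleftrightarrow>
     (\<forall>A \<in> carrier_mat n n. 0 \<le> N A)
   \<and> (\<forall>A \<in> carrier_mat n n. N A = 0 \<longleftrightarrow> A = 0\<^sub>m n n)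
   \<and> (\<forall>c. \<forall>A \<in> carrier_mat n n. N (c \<cdot>\<^sub>m A) = cmod c * N A)
   \<and> (\<forall>A \<in> carrier_mat n n. \<forall>B \<in> carrier_mat n n. N (A + B) \<le> N A + N B)"

definition unitarily_invariant_norm :: "nat \<Rightarrow> (complex mat \<Rightarrow> real) \<Rightarrow> bool" where
  "unitarily_invariant_norm n N \<longleftrightarrow> matrix_norm n N
   \<and> (\<forall>A \<in> carrier_mat n n. \<forall>U V. unitary n U \<longrightarrow> unitary n V \<longrightarrow> N (V * A * U) = N A)"

definition Q_norm :: "nat \<Rightarrow> (complex mat \<Rightarrow> real) \<Rightarrow> bool" where
  "Q_norm n N \<longleftrightarrow> unitarily_invariant_norm n N
   \<and> (\<exists>N'. unitarily_invariant_norm n N'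
        \<and> (\<forall>A \<in> carrier_mat n n. (N A)\<^sup>2 = N' (mat_adjoint A * A)))"

definition norm_sphere :: "nat \<Rightarrow> (complex mat \<Rightarrow> real) \<Rightarrow> complex mat set" where
  "norm_sphere n N = {A \<in> carrier_mat n n. N A = 1}"

text \<open>For Hermitian \<open>D\<close> the trace is real, and taking \<open>Re\<close> only changes its type.\<close>

definition trace_values :: "complex mat \<Rightarrow> complex mat set \<Rightarrow> real set" where
  "trace_values D S = (\<lambda>A. Re (trace (A * D * mat_adjoint A))) ` S"

text \<open>\<open>attains_m D S c\<close> is the assertion \<open>m(D; S) = c\<close>: the infimum is attained and equals \<open>c\<close>.
  Boundedness from below is required because \<open>Inf\<close> is unspecified on sets without a lower
  bound.\<close>

definition attains_m :: "complex mat \<Rightarrow> complex mat set \<Rightarrow> real \<Rightarrow> bool" where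
  "attains_m D S c \<longleftrightarrow> bdd_below (trace_values D S)
     \<and> Inf (trace_values D S) \<in> trace_values D S \<and> Inf (trace_values D S) = c"

definition E_mat :: "nat \<Rightarrow> complex mat" where
  "E_mat n = mat_diag n (\<lambda>i. if i = 0 then 1 else 0)"

end

theory Submission
  imports Defs "Jordan_Normal_Form.Column_Operations"
begin

text \<open>
  Diagonalise the non-negative matrix \<open>D\<close> as \<open>U L U\<^sup>*\<close>, with \<open>L\<close> diagonal with entries
  \<open>l\<^sub>j \<ge> 0\<close>, and put \<open>B = A U\<close>. Then \<open>tr (A D A\<^sup>*) = tr (B L B\<^sup>*)\<close> is the sum of
  \<open>l\<^sub>j |B\<^sub>i\<^sub>j|\<^sup>2\<close> over all entries of \<open>B\<close>, hence at least the smallest eigenvalue \<open>\<mu>\<close> of \<open>D\<close>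
  times the squared Frobenius norm of \<open>B\<close>. Since \<open>N A = N B\<close>, the lower bound amounts to the
  inequality \<open>N(B)\<^sup>2 \<le> N(E)\<^sup>2 tr (B\<^sup>* B)\<close> (lemma \<open>Q_norm_square_le\<close>), which says that among all
  matrices of a given Frobenius norm the multiples of \<open>E\<close> have the largest Q-norm.

  This is where the Q-norm property enters: with \<open>N(A)\<^sup>2 = N'(A\<^sup>* A)\<close> the inequality becomes
  \<open>N'(H) \<le> tr(H) N'(E)\<close> for the non-negative matrix \<open>H = B\<^sup>* B\<close> (note \<open>E\<^sup>* E = E\<close>). It holds for
  every unitarily invariant norm (lemma \<open>norm_le_trace\<close>): after diagonalising \<open>H\<close>, the triangle
  inequality splits it into multiples of the diagonal matrix units, each of which is unitarily
  equivalent to \<open>E\<close>, with coefficients that are non-negative and sum to the trace.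

  For the attainment, let \<open>\<mu>\<close> be the \<open>k\<close>-th diagonal entry of \<open>L\<close> and take \<open>A\<close> such that \<open>B\<close> is
  the \<open>k\<close>-th diagonal matrix unit divided by \<open>N(E)\<close>.

  Everything rests on the spectral theorem for Hermitian matrices, which is proved first by
  splitting off one eigenvector at a time.
\<close>

section \<open>Adjoints, unitary matrices and traces\<close>

lemma index_mat_adjoint [simp]:
  assumes "i < dim_col A" "j < dim_row A"
  shows "mat_adjoint (A :: complex mat) $$ (i, j) = cnj (A $$ (j, i))"
  using assms unfolding mat_adjoint_def by (simp add: mat_of_rows_index)

lemma dim_mat_adjoint [simp]:
  "dim_row (mat_adjoint (A :: complex mat)) = dim_col A"
  "dim_col (mat_adjoint (A :: complex mat)) = dim_row A"
  unfolding mat_adjoint_def by (auto simp: mat_of_rows_def)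

lemma mat_adjoint_carrier [simp]:
  "(A :: complex mat) \<in> carrier_mat n m \<Longrightarrow> mat_adjoint A \<in> carrier_mat m n"
  by auto

lemma mat_adjoint_mat_adjoint [simp]: "mat_adjoint (mat_adjoint A) = (A :: complex mat)"
  by (intro eq_matI) auto

lemma mat_adjoint_mult:
  assumes "(A :: complex mat) \<in> carrier_mat n m" "B \<in> carrier_mat m k"
  shows "mat_adjoint (A * B) = mat_adjoint B * mat_adjoint A"
  using assms by (intro eq_matI) (auto simp: scalar_prod_def mult.commute)

lemma cscalar_prod_mat_adjoint:
  assumes "(A :: complex mat) \<in> carrier_mat n m" "v \<in> carrier_vec m" "w \<in> carrier_vec n"
  shows "(A *\<^sub>v v) \<bullet>c w = v \<bullet>c (mat_adjoint A *\<^sub>v w)"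
proof -
  have "(A *\<^sub>v v) \<bullet>c w = (\<Sum>i<n. \<Sum>j<m. A $$ (i, j) * v $ j * cnj (w $ i))"
    using assms by (simp add: scalar_prod_def sum_distrib_right atLeast0LessThan)
  also have "\<dots> = (\<Sum>j<m. \<Sum>i<n. A $$ (i, j) * v $ j * cnj (w $ i))"
    by (rule sum.swap)
  also have "\<dots> = v \<bullet>c (mat_adjoint A *\<^sub>v w)"
    using assms by (simp add: scalar_prod_def sum_distrib_left atLeast0LessThan mult_ac)
  finally show ?thesis .
qed

lemma unitaryI:
  assumes "U \<in> carrier_mat n n" "mat_adjoint U * U = 1\<^sub>m n"
  shows "unitary n U"
  using assms mat_mult_left_right_inverse[of "mat_adjoint U" n U] unfolding unitary_def by auto

lemma unitaryD:
  assumes "unitary n U"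
  shows "U \<in> carrier_mat n n" "mat_adjoint U * U = 1\<^sub>m n" "U * mat_adjoint U = 1\<^sub>m n"
  using assms unfolding unitary_def by auto

lemma unitary_mat_adjoint: "unitary n U \<Longrightarrow> unitary n (mat_adjoint U)"
  unfolding unitary_def by auto

lemma mult_carrier_mat_square [simp]:
  "A \<in> carrier_mat n n \<Longrightarrow> B \<in> carrier_mat n n \<Longrightarrow> A * B \<in> carrier_mat n n"
  by (rule mult_carrier_mat)

lemma assoc_mult_square:
  "A \<in> carrier_mat n n \<Longrightarrow> B \<in> carrier_mat n n \<Longrightarrow> C \<in> carrier_mat n n \<Longrightarrow> A * B * C = A * (B * C)"
  by (rule assoc_mult_mat)

lemma mult_assoc_cancel:
  fixes A :: "'a :: semiring_1 mat"
  assumes "A \<in> carrier_mat n n" "B \<in> carrier_mat n n" "C \<in> carrier_mat n n" "B * C = 1\<^sub>m n"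
  shows "A * B * C = A"
  by (simp only: assoc_mult_square[OF assms(1-3)] assms(4) right_mult_one_mat[OF assms(1)])

lemma unitary_mult:
  assumes "unitary n U" "unitary n V"
  shows "unitary n (U * V)"
proof (rule unitaryI)
  note [simp] = unitaryD[OF assms(1)] unitaryD[OF assms(2)]
  show "U * V \<in> carrier_mat n n" by (meson unitaryD assms mult_carrier_mat)
  have "mat_adjoint (U * V) * (U * V) = mat_adjoint V * mat_adjoint U * (U * V)"
    by (simp add: mat_adjoint_mult[of _ n n _ n])
  also have "\<dots> = mat_adjoint V * mat_adjoint U * U * V"
    by (rule assoc_mult_mat[symmetric, of _ n n _ n _ n]) auto
  also have "\<dots> = 1\<^sub>m n"
    by (subst mult_assoc_cancel) auto
  finally show "mat_adjoint (U * V) * (U * V) = 1\<^sub>m n" .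
qed

text \<open>
  Lets a diagonalisation be read both as a factorisation of \<open>A\<close> and as a formula for the diagonal
  matrix.
\<close>

lemma unitary_conj_eq_iff:
  assumes "unitary n U" "A \<in> carrier_mat n n" "B \<in> carrier_mat n n"
  shows "mat_adjoint U * A * U = B \<longleftrightarrow> A = U * B * mat_adjoint U"
proof -
  note U = unitaryD[OF assms(1)]
  have 1: "U * (mat_adjoint U * A * U) * mat_adjoint U = A"
  proof -
    have "U * (mat_adjoint U * A * U) * mat_adjoint U
        = U * mat_adjoint U * A * (U * mat_adjoint U)"
      by (simp only: assoc_mult_square[of _ n] mult_carrier_mat_square mat_adjoint_carrier U(1) assms(2))
    then show ?thesis
      unfolding U(3) using assms(2) by simp
  qed
  have 2: "mat_adjoint U * (U * B * mat_adjoint U) * U = B"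
  proof -
    have "mat_adjoint U * (U * B * mat_adjoint U) * U
        = mat_adjoint U * U * B * (mat_adjoint U * U)"
      by (simp only: assoc_mult_square[of _ n] mult_carrier_mat_square mat_adjoint_carrier U(1) assms(3))
    then show ?thesis
      unfolding U(2) using assms(3) by simp
  qed
  show ?thesis
  proof
    assume B: "mat_adjoint U * A * U = B"
    show "A = U * B * mat_adjoint U"
      using 1 unfolding B by (rule sym)
  next
    assume A: "A = U * B * mat_adjoint U"
    show "mat_adjoint U * A * U = B"
      using 2 unfolding A[symmetric] .
  qed
qed

lemma trace_mult_commute:
  assumes "A \<in> carrier_mat n n" "B \<in> carrier_mat n n"
  shows "trace (A * B) = trace (B * A)"
proof -
  have "trace (A * B) = (\<Sum>i<n. \<Sum>j<n. A $$ (i, j) * B $$ (j, i))"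
    using assms by (simp add: trace_def scalar_prod_def atLeast0LessThan)
  also have "\<dots> = (\<Sum>j<n. \<Sum>i<n. A $$ (i, j) * B $$ (j, i))"
    by (rule sum.swap)
  also have "\<dots> = trace (B * A)"
    using assms by (simp add: trace_def scalar_prod_def atLeast0LessThan mult.commute)
  finally show ?thesis .
qed

lemma trace_conj_diag:
  assumes "B \<in> carrier_mat n n"
  shows "trace (B * mat_diag n (\<lambda>i. complex_of_real (l i)) * mat_adjoint B)
       = of_real (\<Sum>i<n. \<Sum>j<n. l j * (cmod (B $$ (i, j)))\<^sup>2)"
proof -
  have "trace (B * mat_diag n (\<lambda>i. complex_of_real (l i)) * mat_adjoint B)
      = (\<Sum>i<n. \<Sum>j<n. B $$ (i, j) * of_real (l j) * cnj (B $$ (i, j)))"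
    using assms
    by (simp add: trace_def mat_diag_mult_right[of _ n n] scalar_prod_def atLeast0LessThan)
  also have "\<dots> = (\<Sum>i<n. \<Sum>j<n. of_real (l j * (cmod (B $$ (i, j)))\<^sup>2))"
    by (intro sum.cong refl) (simp only: of_real_mult complex_norm_square mult_ac)
  finally show ?thesis by simp
qed

section \<open>The spectral theorem for Hermitian matrices\<close>

text \<open>
  Complete \<open>v\<close> to a basis, orthogonalise it, and normalise the columns; Gram-Schmidt leaves the
  first vector fixed, so only its length changes.
\<close>

lemma unitary_with_first_column:
  assumes v: "(v :: complex vec) \<in> carrier_vec n" "v \<noteq> 0\<^sub>v n"
  shows "\<exists>U c. unitary n U \<and> col U 0 = c \<cdot>\<^sub>v v"
proof -
  interpret cof_vec_space n "TYPE(complex)" .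
  define b where "b = basis_completion v"
  define ws where "ws = gram_schmidt n b"
  from basis_completion[OF v, folded b_def]
  have b: "distinct b" "\<not> lin_dep (set b)" "set b \<subseteq> carrier_vec n" "hd b = v" "length b = n"
    by auto
  have n: "n > 0"
    using v by (cases n) auto
  then obtain vs where bv: "b = v # vs"
    using b by (cases b) auto
  from gram_schmidt_result[OF b(3,1,2) refl, folded ws_def]
  have ws: "set ws \<subseteq> carrier_vec n" "corthogonal ws" "length ws = n"
    by (auto simp: b)
  have hdws: "ws ! 0 = v"
    using gram_schmidt_hd[OF v(1), of vs, folded bv, folded ws_def] ws n
    by (cases ws) auto
  \<comment> \<open>The reciprocals of the lengths of the columns, viewed as complex numbers.\<close>
  define r where "r j = complex_of_real (inverse (sqrt (Re (ws ! j \<bullet>c ws ! j))))" for j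
  have cnj_r: "cnj (r j) = r j" for j
    unfolding r_def by (rule complex_cnj_complex_of_real)
  define U where "U = mat n n (\<lambda>(i, j). r j * ws ! j $ i)"
  have wc: "ws ! j \<in> carrier_vec n" if "j < n" for j
    using ws that by auto
  have "mat_adjoint U * U = 1\<^sub>m n"
  proof (intro eq_matI)
    fix i j assume ij: "i < dim_row (1\<^sub>m n :: complex mat)" "j < dim_col (1\<^sub>m n :: complex mat)"
    have "(mat_adjoint U * U) $$ (i, j) = (\<Sum>k<n. cnj (r i * ws ! i $ k) * (r j * ws ! j $ k))"
      using ij by (simp add: U_def scalar_prod_def atLeast0LessThan)
    also have "\<dots> = r i * r j * (ws ! j \<bullet>c ws ! i)"
      using ij wc[of i]
      by (simp add: scalar_prod_def atLeast0LessThan sum_distrib_left cnj_r mult_ac)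
    also have "\<dots> = (if i = j then 1 else 0)"
    proof (cases "i = j")
      case True
      let ?s = "ws ! j \<bullet>c ws ! j"
      have "?s \<noteq> 0"
        using corthogonalD[OF ws(2), of j j] ij ws(3) by auto
      moreover have "?s \<ge> 0"
        by (rule conjugate_square_ge_0_vec)
      ultimately have s: "Re ?s > 0" "?s = of_real (Re ?s)"
        by (auto simp: less_eq_complex_def complex_eq_iff)
      have "r j * r j = of_real (inverse (Re ?s))"
        using s(1) unfolding r_def of_real_mult[symmetric]
        by (simp flip: inverse_mult_distrib of_real_inverse)
      then have "r j * r j * ?s = of_real (inverse (Re ?s) * Re ?s)"
        using s(2) by (metis of_real_mult)
      then show ?thesis using True s(1) by simp
    next
      case False
      then show ?thesis
        using corthogonalD[OF ws(2), of j i] ij ws(3) by auto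
    qed
    finally show "(mat_adjoint U * U) $$ (i, j) = 1\<^sub>m n $$ (i, j)"
      using ij by simp
  qed (auto simp: U_def)
  then have "unitary n U"
    by (intro unitaryI) (auto simp: U_def)
  moreover have "col U 0 = r 0 \<cdot>\<^sub>v v"
    using n v by (intro eq_vecI) (auto simp: U_def hdws)
  ultimately show ?thesis by blast
qed

lemma mat_adjoint_four_block_diag:
  assumes "(A :: complex mat) \<in> carrier_mat k k" "B \<in> carrier_mat m m"
  shows "mat_adjoint (four_block_mat A (0\<^sub>m k m) (0\<^sub>m m k) B)
       = four_block_mat (mat_adjoint A) (0\<^sub>m k m) (0\<^sub>m m k) (mat_adjoint B)"
  using assms by (intro eq_matI) auto

lemma mult_four_block_diag:
  assumes "(A :: complex mat) \<in> carrier_mat k k" "A' \<in> carrier_mat k k"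
    "B \<in> carrier_mat m m" "B' \<in> carrier_mat m m"
  shows "four_block_mat A (0\<^sub>m k m) (0\<^sub>m m k) B * four_block_mat A' (0\<^sub>m k m) (0\<^sub>m m k) B'
       = four_block_mat (A * A') (0\<^sub>m k m) (0\<^sub>m m k) (B * B')"
  using assms by (subst mult_four_block_mat[of _ k k _ m _ m _ _ k _ m]) auto

lemma mat_adjoint_conj:
  assumes "U \<in> carrier_mat n n" "A \<in> carrier_mat n n" "mat_adjoint A = A"
  shows "mat_adjoint (mat_adjoint U * A * U) = mat_adjoint U * A * (U :: complex mat)"
  by (simp only: mat_adjoint_mult[of _ n n _ n] assoc_mult_square[of _ n] mult_carrier_mat_square
      mat_adjoint_carrier mat_adjoint_mat_adjoint assms)

text \<open>
  Conjugating with a unitary matrix \<open>W\<close> whose first column is an eigenvector for \<open>e\<close> turns the first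
  column of \<open>A\<close> into \<open>(e, 0, \<dots>, 0)\<close>. As the conjugate is again Hermitian, its first row has the
  same form and \<open>e\<close> is real, so that what remains is a smaller Hermitian block, to which the
  induction hypothesis applies.
\<close>

theorem hermitian_spectral_theorem:
  assumes "A \<in> carrier_mat n n" "mat_adjoint A = (A :: complex mat)"
  shows "\<exists>U l. unitary n U \<and> A = U * mat_diag n (\<lambda>i. complex_of_real (l i)) * mat_adjoint U"
  using assms
proof (induction n arbitrary: A)
  case 0
  have "unitary 0 (1\<^sub>m 0)" by (intro unitaryI) (auto intro!: eq_matI)
  moreover have "A = 1\<^sub>m 0 * mat_diag 0 (\<lambda>i. complex_of_real 0) * mat_adjoint (1\<^sub>m 0)"
    using 0 by (intro eq_matI) auto
  ultimately show ?case by fastforce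
next
  case (Suc m)
  note A = Suc.prems
  have "spectrum A \<noteq> {}"
    using spectrum_non_empty[OF A(1)] by simp
  then obtain e where "eigenvalue A e"
    unfolding spectrum_def by auto
  then obtain v where v: "v \<in> carrier_vec (Suc m)" "v \<noteq> 0\<^sub>v (Suc m)" "A *\<^sub>v v = e \<cdot>\<^sub>v v"
    using A unfolding eigenvalue_def eigenvector_def by auto
  obtain W c where W: "unitary (Suc m) W" and c: "col W 0 = c \<cdot>\<^sub>v v"
    using unitary_with_first_column[OF v(1,2)] by blast
  note Wc = unitaryD(1)[OF W]
  have W0: "A *\<^sub>v col W 0 = e \<cdot>\<^sub>v col W 0"
    using v A Wc by (simp add: c mult_mat_vec smult_smult_assoc mult.commute)
  \<comment> \<open>\<open>A\<close> in the orthonormal basis formed by the columns of \<open>W\<close>.\<close>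
  define A' where "A' = mat_adjoint W * A * W"
  have A'c: "A' \<in> carrier_mat (Suc m) (Suc m)"
    unfolding A'_def using Wc A by (meson mat_adjoint_carrier mult_carrier_mat)
  have A'h: "mat_adjoint A' = A'"
    unfolding A'_def using mat_adjoint_conj[OF Wc A] .
  have col: "A' $$ (i, 0) = (if i = 0 then e else 0)" if i: "i < Suc m" for i
  proof -
    have "A' = mat_adjoint W * (A * W)"
      unfolding A'_def using Wc A by (auto intro!: assoc_mult_mat)
    then have "A' $$ (i, 0) = row (mat_adjoint W) i \<bullet> (A *\<^sub>v col W 0)"
      using i A Wc col_mult2[OF A(1) Wc, of 0] by simp
    also have "\<dots> = e * (row (mat_adjoint W) i \<bullet> col W 0)"
      using i Wc by (simp add: W0)
    also have "row (mat_adjoint W) i \<bullet> col W 0 = (mat_adjoint W * W) $$ (i, 0)"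
      using i Wc by auto
    finally show ?thesis
      using i unitaryD(2)[OF W] by simp
  qed
  have adj: "A' $$ (i, j) = cnj (A' $$ (j, i))" if "i < Suc m" "j < Suc m" for i j
    using that A'c index_mat_adjoint[of i A' j] unfolding A'h by auto
  have row: "A' $$ (0, i) = (if i = 0 then e else 0)" if "i < Suc m" for i
  proof (cases "i = 0")
    case False
    then show ?thesis
      using that col[of i] adj[of 0 i] by auto
  qed (use col[of 0] in auto)
  define x where "x = Re e"
  have e: "e = of_real x"
  proof -
    have "e = cnj e"
      using adj[of 0 0] col[of 0] by (metis zero_less_Suc)
    then show ?thesis
      unfolding x_def by (auto simp: complex_eq_iff)
  qed
  define A3 where "A3 = mat m m (\<lambda>(i, j). A' $$ (Suc i, Suc j))"
  have A3: "A3 \<in> carrier_mat m m" "mat_adjoint A3 = A3"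
  proof (simp add: A3_def, rule eq_matI)
    fix i j assume ij: "i < dim_row A3" "j < dim_col A3"
    have "mat_adjoint A3 $$ (i, j) = cnj (A' $$ (Suc j, Suc i))"
      using ij by (simp add: A3_def)
    also have "\<dots> = A' $$ (Suc i, Suc j)"
      using ij by (intro adj[symmetric]) (auto simp: A3_def)
    finally show "mat_adjoint A3 $$ (i, j) = A3 $$ (i, j)"
      using ij by (simp add: A3_def)
  qed (auto simp: A3_def)
  from Suc.IH[OF A3] obtain V l where V: "unitary m V"
    and A3V: "A3 = V * mat_diag m (\<lambda>i. complex_of_real (l i)) * mat_adjoint V"
    by blast
  let ?X = "mat 1 1 (\<lambda>_. complex_of_real x)"
  let ?blk = "\<lambda>P Q. four_block_mat P (0\<^sub>m 1 m) (0\<^sub>m m 1) Q"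
  define l' where "l' i = (case i of 0 \<Rightarrow> x | Suc k \<Rightarrow> l k)" for i
  define V' where "V' = ?blk (1\<^sub>m 1) V"
  have adj1: "mat_adjoint (1\<^sub>m 1) = (1\<^sub>m 1 :: complex mat)"
    by (intro eq_matI) auto
  note Vc = unitaryD(1)[OF V]
  have V'a: "mat_adjoint V' = ?blk (1\<^sub>m 1) (mat_adjoint V)"
    unfolding V'_def using Vc by (subst mat_adjoint_four_block_diag) (auto simp: adj1)
  have V'c: "V' \<in> carrier_mat (Suc m) (Suc m)"
    using Vc four_block_carrier_mat[of "1\<^sub>m 1" 1 1 V m m] by (auto simp: V'_def)
  have V': "unitary (Suc m) V'"
  proof (rule unitaryI[OF V'c])
    have "mat_adjoint V' * V' = ?blk (1\<^sub>m 1 * 1\<^sub>m 1) (mat_adjoint V * V)"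
      unfolding V'a unfolding V'_def using Vc by (intro mult_four_block_diag) auto
    also have "\<dots> = 1\<^sub>m (Suc m)"
      using unitaryD(2)[OF V] by (intro eq_matI) auto
    finally show "mat_adjoint V' * V' = 1\<^sub>m (Suc m)" .
  qed
  let ?L = "mat_diag m (\<lambda>i. complex_of_real (l i))"
  let ?L' = "mat_diag (Suc m) (\<lambda>i. complex_of_real (l' i))"
  have L': "?L' = ?blk ?X ?L"
    by (intro eq_matI) (auto simp: mat_diag_def l'_def split: nat.split)
  have VLc: "V * ?L \<in> carrier_mat m m"
    using Vc by (meson mat_diag_dim mult_carrier_mat)
  have "A' = ?blk ?X A3"
    using A'c by (intro eq_matI) (auto simp: A3_def row col e)
  also have "\<dots> = ?blk (1\<^sub>m 1 * ?X * 1\<^sub>m 1) (V * ?L * mat_adjoint V)"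
    unfolding A3V by simp
  also have "\<dots> = ?blk (1\<^sub>m 1 * ?X) (V * ?L) * mat_adjoint V'"
    unfolding V'a using Vc VLc by (intro mult_four_block_diag[symmetric]) auto
  also have "?blk (1\<^sub>m 1 * ?X) (V * ?L) = V' * ?L'"
    unfolding L' unfolding V'_def using Vc by (intro mult_four_block_diag[symmetric]) auto
  finally have A': "A' = V' * ?L' * mat_adjoint V'" .
  have "A = W * A' * mat_adjoint W"
    using unitary_conj_eq_iff[OF W A(1) A'c] A'_def by blast
  also have "\<dots> = W * V' * ?L' * (mat_adjoint V' * mat_adjoint W)"
    unfolding A' by (simp only: assoc_mult_square[of _ "Suc m"] mult_carrier_mat_square mat_adjoint_carrier
        mat_diag_dim Wc V'c)
  also have "mat_adjoint V' * mat_adjoint W = mat_adjoint (W * V')"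
    using mat_adjoint_mult[OF Wc V'c] by simp
  finally show ?case
    using unitary_mult[OF W V'] by blast
qed

text \<open>
  The \<open>i\<close>-th eigenvalue is the value of the quadratic form of \<open>D\<close> at the \<open>i\<close>-th column of \<open>U\<close>,
  hence non-negative.
\<close>

lemma nonneg_hermitian_spectral_theorem:
  assumes D: "D \<in> nonneg_hermitian n"
  shows "\<exists>U l. unitary n U \<and> D = U * mat_diag n (\<lambda>i. complex_of_real (l i)) * mat_adjoint U
           \<and> (\<forall>i<n. l i \<ge> 0)"
proof -
  have Dc: "D \<in> carrier_mat n n" "mat_adjoint D = D"
    and pos: "\<And>v. v \<in> carrier_vec n \<Longrightarrow> 0 \<le> (D *\<^sub>v v) \<bullet>c v"
    using D unfolding nonneg_hermitian_def by auto
  from hermitian_spectral_theorem[OF Dc] obtain U l where U: "unitary n U"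
    and D_eq: "D = U * mat_diag n (\<lambda>i. complex_of_real (l i)) * mat_adjoint U"
    by blast
  note Uc = unitaryD(1)[OF U]
  have diag: "mat_adjoint U * D * U = mat_diag n (\<lambda>i. complex_of_real (l i))"
    by (rule unitary_conj_eq_iff[OF U Dc(1) mat_diag_dim, THEN iffD2, OF D_eq])
  have "l i \<ge> 0" if i: "i < n" for i
  proof -
    have "complex_of_real (l i) = (mat_adjoint U * D * U) $$ (i, i)"
      using i unfolding diag by (simp add: mat_diag_def)
    also have "mat_adjoint U * D * U = mat_adjoint U * (D * U)"
      by (simp only: assoc_mult_square[of _ n] mat_adjoint_carrier Dc Uc)
    also have "\<dots> $$ (i, i) = row (mat_adjoint U) i \<bullet> (D *\<^sub>v col U i)"
      using i Uc Dc col_mult2[OF Dc(1) Uc i] by simp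
    also have "row (mat_adjoint U) i = conjugate (col U i)"
      using i Uc by (intro eq_vecI) auto
    also have "\<dots> \<bullet> (D *\<^sub>v col U i) = (D *\<^sub>v col U i) \<bullet>c col U i"
      using i Uc Dc by (intro comm_scalar_prod[of _ n]) auto
    finally have "complex_of_real (l i) = (D *\<^sub>v col U i) \<bullet>c col U i" .
    moreover have "0 \<le> (D *\<^sub>v col U i) \<bullet>c col U i"
      using Uc by (intro pos) auto
    ultimately have "0 \<le> complex_of_real (l i)"
      by simp
    then show ?thesis
      by (simp add: less_eq_complex_def)
  qed
  then show ?thesis
    using U D_eq by blast
qed

lemma min_eigenvalue_conj_diag:
  assumes U: "unitary n U"
    and D: "D = U * mat_diag n (\<lambda>i. complex_of_real (l i)) * mat_adjoint U"
  shows "min_eigenvalue D = Min (l ` {..<n})"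
proof -
  let ?L = "mat_diag n (\<lambda>i. complex_of_real (l i))"
  note U' = unitaryD[OF U]
  have Dc: "D \<in> carrier_mat n n"
    unfolding D by (simp only: mult_carrier_mat_square mat_adjoint_carrier mat_diag_dim U')
  have "similar_mat_wit D ?L U (mat_adjoint U)"
    using U' Dc D unfolding similar_mat_wit_def Let_def by auto
  then have "char_poly D = char_poly ?L"
    by (intro char_poly_similar) (auto simp: similar_mat_def)
  also have "\<dots> = (\<Prod>a\<leftarrow>diag_mat ?L. [:- a, 1:])"
    by (intro char_poly_upper_triangular[of _ n]) (auto simp: mat_diag_def)
  finally have "spectrum D = set (diag_mat ?L)"
    unfolding spectrum_root_char_poly[OF Dc]
    by (auto simp: poly_prod_list prod_list_zero_iff)
  also have "\<dots> = (\<lambda>i. complex_of_real (l i)) ` {..<n}"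
    by (auto simp: diag_mat_def mat_diag_def)
  finally have "{x. complex_of_real x \<in> spectrum D} = l ` {..<n}"
    by auto
  then show ?thesis
    unfolding min_eigenvalue_def by simp
qed

section \<open>Unitarily invariant norms and the trace\<close>

lemma unitarily_invariant_normD:
  assumes "unitarily_invariant_norm n N"
  shows "A \<in> carrier_mat n n \<Longrightarrow> 0 \<le> N A"
    and "A \<in> carrier_mat n n \<Longrightarrow> N A = 0 \<longleftrightarrow> A = 0\<^sub>m n n"
    and "A \<in> carrier_mat n n \<Longrightarrow> N (c \<cdot>\<^sub>m A) = cmod c * N A"
    and "A \<in> carrier_mat n n \<Longrightarrow> B \<in> carrier_mat n n \<Longrightarrow> N (A + B) \<le> N A + N B"
    and "A \<in> carrier_mat n n \<Longrightarrow> unitary n U \<Longrightarrow> unitary n V \<Longrightarrow> N (V * A * U) = N A"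
  using assms unfolding unitarily_invariant_norm_def matrix_norm_def by auto

definition diag_unit :: "nat \<Rightarrow> nat \<Rightarrow> complex mat" where
  "diag_unit n j = mat_diag n (\<lambda>i. if i = j then 1 else 0)"

lemma diag_unit_carrier [simp]: "diag_unit n j \<in> carrier_mat n n"
  by (simp add: diag_unit_def)

lemma E_mat_eq_diag_unit: "E_mat n = diag_unit n 0"
  by (simp add: E_mat_def diag_unit_def)

lemma unitary_swaprows_mat:
  assumes "k < n" "l < n"
  shows "unitary n (swaprows_mat n k l)"
proof (rule unitaryI)
  have "mat_adjoint (swaprows_mat n k l) = (swaprows_mat n k l :: complex mat)"
    by (intro eq_matI) auto
  then show "mat_adjoint (swaprows_mat n k l) * swaprows_mat n k l = (1\<^sub>m n :: complex mat)"
    using swaprows_mat_inv[OF assms] by simp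
qed simp

text \<open>
  Swapping the basis vectors \<open>0\<close> and \<open>j\<close> is a unitary equivalence that moves the entry of \<open>E\<close> to
  position \<open>j\<close>.
\<close>

lemma norm_diag_unit:
  assumes N: "unitarily_invariant_norm n N" and j: "j < n"
  shows "N (diag_unit n j) = N (E_mat n)"
proof -
  let ?S = "swaprows_mat n 0 j :: complex mat"
  have "?S * diag_unit n 0 * ?S = swapcols 0 j (swaprows 0 j (diag_unit n 0))"
    using j by (subst swapcols_mat[of _ n n], simp, simp, simp)
      (subst swaprows_mat[of _ n n], auto)
  also have "\<dots> = diag_unit n j"
    using j by (intro eq_matI) (auto simp: diag_unit_def mat_diag_def)
  finally show ?thesis
    using unitarily_invariant_normD(5)[OF N diag_unit_carrier[of n 0]
        unitary_swaprows_mat[of 0 n j] unitary_swaprows_mat[of 0 n j]] j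
    by (simp add: E_mat_eq_diag_unit)
qed

lemma norm_mat_diag_le:
  assumes N: "unitarily_invariant_norm n N"
  shows "N (mat_diag n f) \<le> (\<Sum>i<n. cmod (f i)) * N (E_mat n)"
proof -
  \<comment> \<open>Triangle inequality, adding one diagonal entry at a time.\<close>
  let ?d = "\<lambda>k. mat_diag n (\<lambda>i. if i < k then f i else 0)"
  have "N (?d k) \<le> (\<Sum>i<k. cmod (f i)) * N (E_mat n)" if "k \<le> n" for k
    using that
  proof (induction k)
    case 0
    have "?d 0 = 0\<^sub>m n n"
      by (intro eq_matI) (auto simp: mat_diag_def)
    then show ?case
      using unitarily_invariant_normD(2)[OF N, of "0\<^sub>m n n"] by simp
  next
    case (Suc k)
    have "?d (Suc k) = ?d k + f k \<cdot>\<^sub>m diag_unit n k"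
      using Suc.prems by (intro eq_matI) (auto simp: mat_diag_def diag_unit_def less_Suc_eq)
    then have "N (?d (Suc k)) \<le> N (?d k) + N (f k \<cdot>\<^sub>m diag_unit n k)"
      using unitarily_invariant_normD(4)[OF N, of "?d k" "f k \<cdot>\<^sub>m diag_unit n k"] by simp
    also have "N (f k \<cdot>\<^sub>m diag_unit n k) = cmod (f k) * N (E_mat n)"
      using Suc.prems unitarily_invariant_normD(3)[OF N, of "diag_unit n k"]
        norm_diag_unit[OF N, of k] by simp
    finally show ?case
      using Suc by (simp add: distrib_right)
  qed
  moreover have "?d n = mat_diag n f"
    by (intro eq_matI) (auto simp: mat_diag_def)
  ultimately show ?thesis
    by (metis order_refl)
qed

text \<open>
  For a non-negative matrix the sum of the absolute values of the eigenvalues is the trace, so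
  diagonalising reduces the claim to the bound for diagonal matrices.
\<close>

lemma norm_le_trace:
  assumes N: "unitarily_invariant_norm n N" and H: "H \<in> nonneg_hermitian n"
  shows "N H \<le> Re (trace H) * N (E_mat n)"
proof -
  obtain U l where U: "unitary n U" and l: "\<And>i. i < n \<Longrightarrow> l i \<ge> 0"
    and H_eq: "H = U * mat_diag n (\<lambda>i. complex_of_real (l i)) * mat_adjoint U"
    using nonneg_hermitian_spectral_theorem[OF H] by blast
  let ?L = "mat_diag n (\<lambda>i. complex_of_real (l i))"
  note Uc = unitaryD(1)[OF U]
  have "trace H = trace (mat_adjoint U * (U * ?L))"
    unfolding H_eq by (rule trace_mult_commute[of _ n])
      (simp_all only: mult_carrier_mat_square mat_adjoint_carrier mat_diag_dim Uc)
  also have "mat_adjoint U * (U * ?L) = mat_adjoint U * U * ?L"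
    by (simp only: assoc_mult_square[of _ n] mat_adjoint_carrier mat_diag_dim Uc)
  also have "\<dots> = ?L"
    unfolding unitaryD(2)[OF U] by (rule left_mult_one_mat[of _ n n]) simp
  finally have tr: "Re (trace H) = (\<Sum>i<n. l i)"
    by (simp add: trace_def mat_diag_def)
  have "N H = N ?L"
    unfolding H_eq using unitarily_invariant_normD(5)[OF N mat_diag_dim] U unitary_mat_adjoint
    by blast
  also have "\<dots> \<le> (\<Sum>i<n. cmod (complex_of_real (l i))) * N (E_mat n)"
    by (rule norm_mat_diag_le[OF N])
  also have "(\<Sum>i<n. cmod (complex_of_real (l i))) = (\<Sum>i<n. l i)"
    using l by (intro sum.cong) auto
  finally show ?thesis
    unfolding tr .
qed

lemma mat_adjoint_mult_self_nonneg_hermitian: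
  assumes B: "B \<in> carrier_mat n n"
  shows "mat_adjoint B * B \<in> nonneg_hermitian n"
proof -
  have "mat_adjoint (mat_adjoint B * B) = mat_adjoint B * B"
    by (simp only: mat_adjoint_mult[of _ n n _ n] mat_adjoint_carrier mat_adjoint_mat_adjoint B)
  moreover have "0 \<le> (mat_adjoint B * B *\<^sub>v v) \<bullet>c v" if v: "v \<in> carrier_vec n" for v
  proof -
    have Bv: "B *\<^sub>v v \<in> carrier_vec n"
      using B v by auto
    have "mat_adjoint B * B *\<^sub>v v = mat_adjoint B *\<^sub>v (B *\<^sub>v v)"
      using B v by (intro assoc_mult_mat_vec[of _ n n _ n]) auto
    also have "\<dots> \<bullet>c v = (B *\<^sub>v v) \<bullet>c (B *\<^sub>v v)"
      using cscalar_prod_mat_adjoint[OF mat_adjoint_carrier[OF B] Bv v] by simp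
    also have "\<dots> \<ge> 0"
      by (rule conjugate_square_ge_0_vec)
    finally show ?thesis .
  qed
  ultimately show ?thesis
    using B unfolding nonneg_hermitian_def by auto
qed

lemma trace_mat_adjoint_mult_self:
  assumes B: "B \<in> carrier_mat n n"
  shows "trace (mat_adjoint B * B) = of_real (\<Sum>i<n. \<Sum>j<n. (cmod (B $$ (i, j)))\<^sup>2)"
proof -
  have "trace (mat_adjoint B * B) = trace (B * mat_adjoint B)"
    using B by (intro trace_mult_commute[of _ n]) auto
  also have "B * mat_adjoint B = B * mat_diag n (\<lambda>i. complex_of_real 1) * mat_adjoint B"
    using B by simp
  finally show ?thesis
    using trace_conj_diag[OF B, of "\<lambda>_. 1"] by simp
qed

text \<open>
  The double sum is the trace of \<open>B\<^sup>* B\<close>; the inequality is \<open>norm_le_trace\<close> for the norm \<open>N'\<close> that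
  belongs to the Q-norm, applied to \<open>B\<^sup>* B\<close>.
\<close>

lemma Q_norm_square_le:
  assumes Q: "Q_norm n N" and B: "B \<in> carrier_mat n n"
  shows "(N B)\<^sup>2 \<le> (N (E_mat n))\<^sup>2 * (\<Sum>i<n. \<Sum>j<n. (cmod (B $$ (i, j)))\<^sup>2)"
proof -
  obtain N' where N': "unitarily_invariant_norm n N'"
    and sq: "\<And>A. A \<in> carrier_mat n n \<Longrightarrow> (N A)\<^sup>2 = N' (mat_adjoint A * A)"
    using Q unfolding Q_norm_def by blast
  have E: "mat_adjoint (E_mat n) = E_mat n"
    by (intro eq_matI) (auto simp: E_mat_def mat_diag_def)
  have "E_mat n * E_mat n = E_mat n"
    unfolding E_mat_def by (simp add: if_distrib cong: if_cong)
  then have NE: "(N (E_mat n))\<^sup>2 = N' (E_mat n)"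
    using sq[of "E_mat n"] E by (simp add: E_mat_eq_diag_unit)
  have "(N B)\<^sup>2 = N' (mat_adjoint B * B)"
    by (rule sq[OF B])
  also have "\<dots> \<le> Re (trace (mat_adjoint B * B)) * N' (E_mat n)"
    by (rule norm_le_trace[OF N' mat_adjoint_mult_self_nonneg_hermitian[OF B]])
  finally show ?thesis
    unfolding trace_mat_adjoint_mult_self[OF B] NE by (simp add: mult.commute)
qed

section \<open>The minimum of the trace over the unit sphere\<close>

theorem proposition4p1:
  fixes n :: nat and N :: "complex mat \<Rightarrow> real" and D :: "complex mat"
  assumes "n \<ge> 1"
    and "Q_norm n N"
    and "D \<in> nonneg_hermitian n"
  shows "attains_m D (norm_sphere n N) (inverse ((N (E_mat n))\<^sup>2) * min_eigenvalue D)"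
proof -
  have N: "unitarily_invariant_norm n N"
    using assms(2) unfolding Q_norm_def by blast
  obtain U l where U: "unitary n U" and l: "\<And>i. i < n \<Longrightarrow> l i \<ge> 0"
    and D_eq: "D = U * mat_diag n (\<lambda>i. complex_of_real (l i)) * mat_adjoint U"
    using nonneg_hermitian_spectral_theorem[OF assms(3)] by blast
  let ?L = "mat_diag n (\<lambda>i. complex_of_real (l i))"
  let ?F = "\<lambda>B. \<Sum>i<n. \<Sum>j<n. (cmod (B $$ (i, j)))\<^sup>2"
  note Uc = unitaryD(1)[OF U]
  define \<mu> where "\<mu> = min_eigenvalue D"
  have \<mu>: "\<mu> = Min (l ` {..<n})"
    unfolding \<mu>_def by (rule min_eigenvalue_conj_diag[OF U D_eq])
  have \<mu>_le: "\<mu> \<le> l j" if "j < n" for j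
    unfolding \<mu> using that by (intro Min_le) auto
  have "\<mu> \<in> l ` {..<n}"
    unfolding \<mu> using assms(1) by (intro Min_in) (auto simp: lessThan_empty_iff)
  then obtain k where k: "k < n" "l k = \<mu>"
    by auto
  have "E_mat n $$ (0, 0) = 1"
    using assms(1) by (auto simp: E_mat_def mat_diag_def)
  then have "E_mat n \<noteq> 0\<^sub>m n n"
    using assms(1) by auto
  then have E_pos: "N (E_mat n) > 0"
    using unitarily_invariant_normD(1,2)[OF N, of "E_mat n"]
    by (simp add: E_mat_eq_diag_unit order_less_le)
  have trace_eq: "Re (trace (A * D * mat_adjoint A))
      = (\<Sum>i<n. \<Sum>j<n. l j * (cmod ((A * U) $$ (i, j)))\<^sup>2)"
    if A: "A \<in> carrier_mat n n" for A
  proof -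
    have "A * D * mat_adjoint A = A * U * ?L * mat_adjoint (A * U)"
      unfolding D_eq
      by (simp only: mat_adjoint_mult[of _ n n _ n] assoc_mult_square[of _ n]
          mult_carrier_mat_square mat_adjoint_carrier mat_diag_dim A Uc)
    then show ?thesis
      using trace_conj_diag[of "A * U" n l] A Uc by simp
  qed
  have lower: "inverse ((N (E_mat n))\<^sup>2) * \<mu> \<le> x" if x: "x \<in> trace_values D (norm_sphere n N)" for x
  proof -
    obtain A where A: "A \<in> carrier_mat n n" "N A = 1" and x_eq: "x = Re (trace (A * D * mat_adjoint A))"
      using x unfolding trace_values_def norm_sphere_def by auto
    let ?B = "A * U"
    have Bc: "?B \<in> carrier_mat n n"
      using A Uc by simp
    have "N (1\<^sub>m n * A * U) = N A"
      using A U by (intro unitarily_invariant_normD(5)[OF N]) (auto intro!: unitaryI eq_matI)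
    then have "1 \<le> (N (E_mat n))\<^sup>2 * ?F ?B"
      using Q_norm_square_le[OF assms(2) Bc] A by simp
    then have "inverse ((N (E_mat n))\<^sup>2) \<le> ?F ?B"
      using E_pos by (simp add: field_simps)
    then have "inverse ((N (E_mat n))\<^sup>2) * \<mu> \<le> ?F ?B * \<mu>"
      using l[of k] k by (intro mult_right_mono) auto
    also have "\<dots> = (\<Sum>i<n. \<Sum>j<n. \<mu> * (cmod (?B $$ (i, j)))\<^sup>2)"
      by (simp add: sum_distrib_left mult.commute)
    also have "\<dots> \<le> (\<Sum>i<n. \<Sum>j<n. l j * (cmod (?B $$ (i, j)))\<^sup>2)"
      by (intro sum_mono mult_right_mono \<mu>_le) auto
    also have "\<dots> = x"
      unfolding x_eq trace_eq[OF A(1)] ..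
    finally show ?thesis .
  qed
  have attained: "inverse ((N (E_mat n))\<^sup>2) * \<mu> \<in> trace_values D (norm_sphere n N)"
  proof -
    \<comment> \<open>The rows of the minimiser vanish except row \<open>k\<close>, which is the adjoint of an eigenvector
      for \<open>\<mu>\<close>, scaled to give norm one.\<close>
    let ?c = "complex_of_real (inverse (N (E_mat n)))"
    let ?M = "?c \<cdot>\<^sub>m diag_unit n k"
    define A where "A = ?M * mat_adjoint U"
    have Mc: "?M \<in> carrier_mat n n"
      by simp
    have Ac: "A \<in> carrier_mat n n"
      unfolding A_def by (simp only: mult_carrier_mat_square mat_adjoint_carrier Mc Uc)
    have "N (1\<^sub>m n * ?M * mat_adjoint U) = N ?M"
      using U unitary_mat_adjoint
      by (intro unitarily_invariant_normD(5)[OF N Mc]) (auto intro!: unitaryI eq_matI)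
    also have "\<dots> = 1"
      using E_pos norm_diag_unit[OF N k(1)] unitarily_invariant_normD(3)[OF N diag_unit_carrier]
      by (simp add: norm_inverse)
    finally have "N A = 1"
      unfolding A_def left_mult_one_mat[OF Mc] .
    moreover have "Re (trace (A * D * mat_adjoint A)) = inverse ((N (E_mat n))\<^sup>2) * \<mu>"
    proof -
      have "A * U = ?M * (mat_adjoint U * U)"
        unfolding A_def by (simp only: assoc_mult_square[of _ n] mat_adjoint_carrier Mc Uc)
      then have AU: "A * U = ?M"
        unfolding unitaryD(2)[OF U] using right_mult_one_mat[OF Mc] by simp
      have "(\<Sum>i<n. \<Sum>j<n. l j * (cmod (?M $$ (i, j)))\<^sup>2)
          = (\<Sum>i<n. \<Sum>j<n. if j = k then if i = k then l k * inverse ((N (E_mat n))\<^sup>2) else 0 else 0)"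
        by (intro sum.cong refl)
          (auto simp: diag_unit_def mat_diag_def power_inverse norm_inverse)
      also have "\<dots> = inverse ((N (E_mat n))\<^sup>2) * \<mu>"
        using k by (simp add: mult.commute)
      finally show ?thesis
        unfolding trace_eq[OF Ac] AU .
    qed
    ultimately show ?thesis
      using Ac unfolding trace_values_def norm_sphere_def by (intro image_eqI[of _ _ A]) auto
  qed
  have "Inf (trace_values D (norm_sphere n N)) = inverse ((N (E_mat n))\<^sup>2) * \<mu>"
    using lower attained by (rule cInf_eq_minimum[rotated])
  moreover have "bdd_below (trace_values D (norm_sphere n N))"
    using lower by (rule bdd_belowI)
  ultimately show ?thesis
    using attained unfolding attains_m_def \<mu>_def by simp
qed

end
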